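(* Let $s\in(0,1)$ and let $g:\mathbb{R}^N\to\mathbb{R}$ be a measurable function which is bounded from above and coercive, i.e. $\lim_{|x|\to+\infty}g(x)=-\infty$. Then for every $m>0$ there exists a minimizer of $$\min_{|E|=m}\left(P_s(E)-\int_E g(x)\,dx\right).$$
   Context: $N$ is the space dimension (a positive integer). $|\cdot|$ denotes Lebesgue measure on $\mathbb{R}^N$. For $s\in(0,1)$ and a measurable set $E\subset\mathbb{R}^N$ with complement $E^c=\mathbb{R}^N\setminus E$, the fractional perimeter is $$P_s(E)=\int_E\int_{E^c}\frac{1}{|x-y|^{N+s}}\,dx\,dy\in[0,+\infty].$$ The minimization is over all measurable sets $E\subset\mathbb{R}^N$ with $|E|=m$; since $g$ is bounded from above, the functional takes values in $(-\infty,+\infty]$. *)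

theory Defs
  imports "HOL-Analysis.Analysis"
begin

definition frac_perimeter :: "real \<Rightarrow> 'a::euclidean_space set \<Rightarrow> ennreal" where
  "frac_perimeter s E =
     (\<integral>\<^sup>+y\<in>E. (\<integral>\<^sup>+x\<in>- E. ennreal (1 / norm (x - y) powr (real DIM('a) + s)) \<partial>lebesgue) \<partial>lebesgue)"

(* The Bochner integral would give 0 when g is not integrable on E, whereas here the integral
   must be allowed to be -\<infinity>.  Since ennreal truncates negative reals to 0, the two terms are
   the integrals of the positive and the negative part of g.  When g is bounded above and E has
   finite measure, the first term is finite, so \<infinity> - \<infinity> does not occur. *)
definition ext_set_integral :: "'a::euclidean_space set \<Rightarrow> ('a \<Rightarrow> real) \<Rightarrow> ereal" where
  "ext_set_integral E g =
     enn2ereal (\<integral>\<^sup>+x\<in>E. ennreal (g x) \<partial>lebesgue) - enn2ereal (\<integral>\<^sup>+x\<in>E. ennreal (- g x) \<partial>lebesgue)"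

definition energy :: "real \<Rightarrow> ('a::euclidean_space \<Rightarrow> real) \<Rightarrow> 'a set \<Rightarrow> ereal" where
  "energy s g E = enn2ereal (frac_perimeter s E) - ext_set_integral E g"

end

theory Submission
  imports Defs "HOL-Complex_Analysis.Great_Picard"
begin

text \<open>
  Direct method.  With an upper bound \<open>M\<close> of \<open>g\<close>, the energy on sets of measure \<open>m\<close> is
  \<open>P\<^sub>s(E) + \<integral>\<^sub>E (M - g)\<close> up to the constant \<open>M m\<close>; this is nonnegative and, by Fatou, lower
  semicontinuous under a.e. convergence of indicators.  Along a minimizing sequence coercivity
  prevents loss of mass at infinity.  Local compactness comes from a cubic grid of side \<open>h\<close>: since
  points of one cell \<open>Q\<close> are at distance at most \<open>N h\<close>, the sum of \<open>|E \<inter> Q| |Q - E| / |Q|\<close> over the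
  cells is at most \<open>C h\<^sup>s P\<^sub>s(E)\<close>, so sets of bounded perimeter are determined in measure, up to
  \<open>O(h\<^sup>s)\<close>, by their masses \<open>|E \<inter> Q|\<close>.  A diagonal subsequence along which all these masses
  converge is therefore Cauchy in measure, and Borel-Cantelli yields an a.e. limit.
\<close>

section \<open>Semicontinuity and the nonnegative form of the energy\<close>

abbreviation frac_kernel :: "real \<Rightarrow> 'a::euclidean_space \<Rightarrow> 'a \<Rightarrow> ennreal" where
  "frac_kernel s x y \<equiv> ennreal (1 / norm (x - y) powr (real DIM('a) + s))"

lemma lebesgue_set_AE_eq_borel:
  fixes E :: "'a::euclidean_space set"
  assumes "E \<in> sets lebesgue"
  obtains B where "B \<in> sets borel" "AE x in lebesgue. x \<in> E \<longleftrightarrow> x \<in> B"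
proof -
  have "AE x in lebesgue. x \<notin> null_part lborel E"
    using AE_notin_null_part[of E lborel] assms by (simp add: AE_completion_iff)
  then have "AE x in lebesgue. x \<in> E \<longleftrightarrow> x \<in> main_part lborel E"
    by eventually_elim (use main_part_null_part_Un[of E lborel] assms in blast)
  moreover have "main_part lborel E \<in> sets borel"
    using main_part_sets[of E lborel] assms by simp
  ultimately show thesis using that by blast
qed

text \<open>Measurability of a parametrized integral comes from joint measurability, which the Borel
  setting with \<open>lborel\<close> provides. Replacing \<open>E\<close> by an a.e. equal Borel set
  leaves the integral unchanged for every \<open>y\<close>, so the claim reduces to that
  setting.\<close>

lemma borel_measurable_frac_kernel_integral:
  fixes E :: "'a::euclidean_space set"
  assumes "E \<in> sets lebesgue"
  shows "(\<lambda>y. \<integral>\<^sup>+x\<in>- E. frac_kernel s x y \<partial>lebesgue) \<in> borel_measurable lebesgue"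
proof -
  obtain B where B [measurable]: "B \<in> sets borel" and eq: "AE x in lebesgue. x \<in> E \<longleftrightarrow> x \<in> B"
    using lebesgue_set_AE_eq_borel[OF assms] .
  have "(\<integral>\<^sup>+x\<in>- E. frac_kernel s x y \<partial>lebesgue) = (\<integral>\<^sup>+x\<in>- B. frac_kernel s x y \<partial>lborel)" for y
  proof -
    have "(\<integral>\<^sup>+x\<in>- E. frac_kernel s x y \<partial>lebesgue) = (\<integral>\<^sup>+x\<in>- B. frac_kernel s x y \<partial>lebesgue)"
      by (rule nn_integral_cong_AE) (use eq in eventually_elim, auto simp: indicator_def)
    then show ?thesis by (simp add: nn_integral_completion)
  qed
  moreover have "(\<lambda>y. \<integral>\<^sup>+x\<in>- B. frac_kernel s x y \<partial>lborel) \<in> borel_measurable borel"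
    by measurable
  ultimately show ?thesis
    by (simp add: borel_measurable_if_D measurable_completion)
qed

text \<open>Fatou is applied twice: to the inner integral for each fixed \<open>y\<close>, then to
  the outer integral over \<open>E n\<close>.\<close>

lemma frac_perimeter_plus_potential_lsc:
  fixes E :: "nat \<Rightarrow> 'a::euclidean_space set" and G :: "'a \<Rightarrow> ennreal"
  assumes E [measurable]: "\<And>n. E n \<in> sets lebesgue" and A [measurable]: "A \<in> sets lebesgue"
    and G [measurable]: "G \<in> borel_measurable lebesgue"
    and lim: "AE x in lebesgue. eventually (\<lambda>n. x \<in> E n \<longleftrightarrow> x \<in> A) sequentially"
  shows "frac_perimeter s A + (\<integral>\<^sup>+x\<in>A. G x \<partial>lebesgue)
    \<le> liminf (\<lambda>n. frac_perimeter s (E n) + (\<integral>\<^sup>+x\<in>E n. G x \<partial>lebesgue))"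
proof -
  define J where "J B y = (\<integral>\<^sup>+x\<in>- B. frac_kernel s x y \<partial>lebesgue)" for B :: "'a set" and y
  have J [measurable]: "J B \<in> borel_measurable lebesgue" if "B \<in> sets lebesgue" for B
    using borel_measurable_frac_kernel_integral[OF that] by (simp add: J_def[abs_def])
  have k [measurable]: "(\<lambda>x. frac_kernel s x y) \<in> borel_measurable lebesgue" for y :: 'a
    by (rule measurable_completion) measurable
  \<comment> \<open>With the potential moved under the outer integral, one use of Fatou there covers
    perimeter and potential together.\<close>
  have split: "frac_perimeter s B + (\<integral>\<^sup>+x\<in>B. G x \<partial>lebesgue) = (\<integral>\<^sup>+y\<in>B. (J B y + G y) \<partial>lebesgue)"
    if [measurable]: "B \<in> sets lebesgue" for B
    unfolding frac_perimeter_def J_def[symmetric]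
    by (subst nn_integral_add[symmetric]) (auto simp: distrib_right)
  have J_le: "J A y \<le> liminf (\<lambda>n. J (E n) y)" for y
  proof -
    have "J A y = (\<integral>\<^sup>+x. liminf (\<lambda>n. frac_kernel s x y * indicator (- E n) x) \<partial>lebesgue)"
      unfolding J_def
    proof (rule nn_integral_cong_AE, use lim in eventually_elim)
      case (elim x)
      have "(\<lambda>n. frac_kernel s x y * indicator (- E n) x) \<longlonglongrightarrow> frac_kernel s x y * indicator (- A) x"
        by (rule tendsto_eventually) (use elim in eventually_elim, auto simp: indicator_def)
      then show ?case by (simp add: lim_imp_Liminf)
    qed
    also have "\<dots> \<le> liminf (\<lambda>n. J (E n) y)"
      unfolding J_def by (rule nn_integral_liminf) measurable
    finally show ?thesis .
  qed
  have "(\<integral>\<^sup>+y\<in>A. (J A y + G y) \<partial>lebesgue)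
      \<le> (\<integral>\<^sup>+y. liminf (\<lambda>n. (J (E n) y + G y) * indicator (E n) y) \<partial>lebesgue)"
  proof (rule nn_integral_mono_AE, use lim in eventually_elim)
    case (elim y)
    show ?case
    proof (cases "y \<in> A")
      case True
      have "J A y + G y \<le> liminf (\<lambda>n. J (E n) y) + G y"
        using J_le by (rule add_right_mono)
      also have "\<dots> = liminf (\<lambda>n. J (E n) y + G y)"
        by (subst Liminf_add_const) auto
      also have "\<dots> = liminf (\<lambda>n. (J (E n) y + G y) * indicator (E n) y)"
        by (rule Liminf_eq, use elim in eventually_elim) (use True in auto)
      finally show ?thesis using True by simp
    qed simp
  qed
  also have "\<dots> \<le> liminf (\<lambda>n. \<integral>\<^sup>+y\<in>E n. (J (E n) y + G y) \<partial>lebesgue)"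
    by (rule nn_integral_liminf) measurable
  finally show ?thesis by (simp add: split)
qed

text \<open>Up to a constant, the signed energy becomes a sum of two nonnegative terms, to which
  Fatou applies. The rearrangement is legitimate because the positive part of \<open>g\<close> has
  finite integral over \<open>E\<close>.\<close>

lemma energy_eq:
  fixes E :: "'a::euclidean_space set"
  assumes E [measurable]: "E \<in> sets lebesgue" and m: "emeasure lebesgue E = ennreal m" "0 \<le> m"
    and g [measurable]: "g \<in> borel_measurable lebesgue" and M: "\<And>x. g x \<le> M" "0 \<le> M"
  shows "energy s g E = enn2ereal (frac_perimeter s E + (\<integral>\<^sup>+x\<in>E. ennreal (M - g x) \<partial>lebesgue)) - ereal (M * m)"
proof -
  define P where "P = (\<integral>\<^sup>+x\<in>E. ennreal (g x) \<partial>lebesgue)"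
  define N where "N = (\<integral>\<^sup>+x\<in>E. ennreal (- g x) \<partial>lebesgue)"
  define D where "D = (\<integral>\<^sup>+x\<in>E. ennreal (M - g x) \<partial>lebesgue)"
  \<comment> \<open>The pointwise identity \<open>(M - g) + g^+ = M + g^-\<close> is integrated as a
    sum of nonnegative terms, so nothing infinite is subtracted.\<close>
  have "D + P = (\<integral>\<^sup>+x\<in>E. (ennreal M + ennreal (- g x)) \<partial>lebesgue)"
    unfolding D_def P_def
  proof (subst nn_integral_add[symmetric])
    show "(\<integral>\<^sup>+x. ennreal (M - g x) * indicator E x + ennreal (g x) * indicator E x \<partial>lebesgue) =
        (\<integral>\<^sup>+x\<in>E. (ennreal M + ennreal (- g x)) \<partial>lebesgue)"
    proof (intro nn_integral_cong)
      fix x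
      have "ennreal (M - g x) + ennreal (g x) = ennreal M + ennreal (- g x)"
        using M(1)[of x] M(2)
        by (cases "0 \<le> g x") (auto simp: ennreal_plus[symmetric] ennreal_neg simp del: ennreal_plus)
      then show "ennreal (M - g x) * indicator E x + ennreal (g x) * indicator E x =
          (ennreal M + ennreal (- g x)) * indicator E x"
        by (metis distrib_right)
    qed
  qed auto
  also have "\<dots> = ennreal (M * m) + N"
    unfolding N_def by (subst distrib_right, subst nn_integral_add)
      (auto simp: nn_integral_cmult m ennreal_mult M(2))
  finally have DP: "D + P = ennreal (M * m) + N" .
  have "P \<le> (\<integral>\<^sup>+x\<in>E. ennreal M \<partial>lebesgue)"
    unfolding P_def by (intro nn_integral_mono) (auto simp: indicator_def M intro!: ennreal_leI)
  also have "\<dots> = ennreal (M * m)"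
    by (simp add: nn_integral_cmult m ennreal_mult M(2))
  finally have "P < top" by (rule le_less_trans) simp
  then have "P \<noteq> top" by simp
  then obtain p where p: "P = ennreal p" "0 \<le> p" by (cases P) auto
  have Mm: "0 \<le> M * m" using M(2) m(2) by simp
  show ?thesis
  proof (cases "N = top \<or> frac_perimeter s E = top")
    \<comment> \<open>Both sides are plus infinity here: as \<open>P\<close> is finite,
      \<open>N = top\<close> forces \<open>D = top\<close>.\<close>
    case True
    then have "N = top \<Longrightarrow> D = top" using DP p by (auto simp: ennreal_add_eq_top)
    with True show ?thesis
      unfolding energy_def ext_set_integral_def P_def[symmetric] N_def[symmetric] D_def[symmetric] p(1)
      using p(2) by (cases "frac_perimeter s E"; cases N) (auto simp: top_ennreal.rep_eq)
  next
    case False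
    then obtain n q where n: "N = ennreal n" "0 \<le> n" and q: "frac_perimeter s E = ennreal q" "0 \<le> q"
      by (cases N; cases "frac_perimeter s E") auto
    have "D + P < top" unfolding DP n(1) by simp
    then have "D \<noteq> top" by auto
    then obtain d where d: "D = ennreal d" "0 \<le> d" by (cases D) auto
    have "d + p = M * m + n"
      using DP n p d Mm by (auto simp: ennreal_plus[symmetric] simp del: ennreal_plus)
    then show ?thesis
      unfolding energy_def ext_set_integral_def P_def[symmetric] N_def[symmetric] D_def[symmetric]
        p(1) n(1) q(1) d(1)
      using p(2) n(2) q(2) d(2) by (auto simp: ennreal_plus[symmetric] simp del: ennreal_plus)
  qed
qed

section \<open>The symmetric difference inside one cell\<close>

text \<open>
  Here \<open>c\<close>, \<open>d\<close>, \<open>e\<close>, \<open>q\<close> stand for the measures of \<open>A \<inter> B\<close>, \<open>A - B\<close>, \<open>B - A\<close> inside a cell, and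
  of the cell itself.
\<close>
lemma symm_diff_cell_inequality:
  fixes c d e q :: real
  assumes "0 \<le> c" "0 \<le> d" "0 \<le> e" "0 < q" "c + d + e \<le> q"
  shows "d + e \<le> 2 * ((c + d) * (q - (c + d)) + (c + e) * (q - (c + e))) / q + \<bar>(c + d) - (c + e)\<bar>"
proof -
  define r where "r = q - c - d - e"
  have r: "0 \<le> r" "q = c + d + e + r" using assms by (auto simp: r_def)
  \<comment> \<open>With \<open>q = c + d + e + r\<close> the right side is
    \<open>(c + d) * (e + r) + (c + e) * (d + r)\<close>. Its terms \<open>c * e\<close>,
    \<open>2 * d * e\<close> and \<open>d * r\<close> dominate \<open>min d e\<close> times
    \<open>c\<close>, \<open>d + e\<close> and \<open>r\<close>.\<close>
  have *: "q * min d e \<le> (c + d) * (q - (c + d)) + (c + e) * (q - (c + e))"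
  proof -
    have "min d e * min d e \<le> d * e"
      using assms by (intro mult_mono) auto
    moreover have "c * min d e \<le> c * e" "d * min d e + e * min d e = d * e + min d e * min d e"
      "r * min d e \<le> r * d"
      using assms r by (auto intro!: mult_left_mono simp: min_def)
    moreover have "0 \<le> c * r" "0 \<le> c * d" "0 \<le> r * e" "0 \<le> d * e"
      using assms r by auto
    ultimately show ?thesis unfolding r(2) by (simp add: algebra_simps)
  qed
  have "d + e = 2 * min d e + \<bar>(c + d) - (c + e)\<bar>" by (auto simp: min_def)
  with * assms(4) show ?thesis by (simp add: field_simps)
qed

text \<open>Each product is small when the set nearly fills or nearly misses \<open>Q\<close>. If
  this holds for \<open>A\<close> and for \<open>B\<close>, their masses in \<open>Q\<close> decide
  whether they nearly coincide there.\<close>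

lemma measure_symm_diff_Int_cell_le:
  fixes M :: "'a measure"
  assumes [measurable]: "A \<in> sets M" "B \<in> sets M" and Q: "Q \<in> fmeasurable M" "0 < measure M Q"
  shows "measure M (sym_diff A B \<inter> Q)
    \<le> 2 * (measure M (A \<inter> Q) * measure M (Q - A) + measure M (B \<inter> Q) * measure M (Q - B)) / measure M Q
      + \<bar>measure M (A \<inter> Q) - measure M (B \<inter> Q)\<bar>"
proof -
  have [measurable]: "Q \<in> sets M" using Q by auto
  have fm: "S \<inter> Q \<in> fmeasurable M" if "S \<in> sets M" for S
    using Q that by (simp add: fmeasurable_Int_fmeasurable Int_commute)
  have add: "measure M ((S \<union> T) \<inter> Q) = measure M (S \<inter> Q) + measure M (T \<inter> Q)"
    if "S \<in> sets M" "T \<in> sets M" "S \<inter> T = {}" for S T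
    using that by (subst Int_Un_distrib2, intro measure_Un_AE AE_I2) (auto intro: fm)
  let ?c = "measure M (A \<inter> B \<inter> Q)" and ?d = "measure M ((A - B) \<inter> Q)" and ?e = "measure M ((B - A) \<inter> Q)"
  have "A \<inter> B \<union> (A - B) = A" "A \<inter> B \<union> (B - A) = B" by auto
  then have a: "measure M (A \<inter> Q) = ?c + ?d" and b: "measure M (B \<inter> Q) = ?c + ?e"
    using add[of "A \<inter> B" "A - B"] add[of "A \<inter> B" "B - A"] by auto
  have de: "measure M (sym_diff A B \<inter> Q) = ?d + ?e"
    by (rule add) auto
  have compl: "measure M (Q - S) = measure M Q - measure M (S \<inter> Q)" if "S \<in> sets M" for S
  proof -
    have "measure M (Q - S \<inter> Q) = measure M Q - measure M (S \<inter> Q)"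
      using that by (intro measurable_measure_Diff Q) auto
    moreover have "Q - S \<inter> Q = Q - S" by auto
    ultimately show ?thesis by simp
  qed
  have "?c + ?d + ?e = measure M ((A \<union> B) \<inter> Q)"
    using add[of A "B - A"] a by (simp add: Un_Diff_cancel)
  also have "\<dots> \<le> measure M Q"
    by (intro measure_mono_fmeasurable Q) auto
  finally show ?thesis
    unfolding compl[OF assms(1)] compl[OF assms(2)] a b de
    by (intro symm_diff_cell_inequality Q) auto
qed

section \<open>The grid of cubes\<close>

text \<open>For \<open>0 < h\<close> this is the half-open cube of side \<open>h\<close> with lowest
  corner \<open>h z\<close>. Half-openness makes the cells partition the space exactly, with no
  shared faces.\<close>

definition grid_cell :: "real \<Rightarrow> int ^ 'n \<Rightarrow> (real ^ 'n) set" where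
  "grid_cell h z = {x. \<forall>i. \<lfloor>x $ i / h\<rfloor> = z $ i}"

lemma grid_cell_borel [measurable]: "grid_cell h z \<in> sets borel"
  unfolding grid_cell_def by measurable

lemma grid_cell_disjoint: "x \<in> grid_cell h z \<Longrightarrow> x \<in> grid_cell h w \<Longrightarrow> z = w"
  by (auto simp: grid_cell_def vec_eq_iff)

lemma mem_grid_cell: "x \<in> grid_cell h (\<chi> i. \<lfloor>x $ i / h\<rfloor>)"
  by (simp add: grid_cell_def)

lemma grid_cell_iff:
  assumes "0 < h"
  shows "x \<in> grid_cell h z \<longleftrightarrow> (\<forall>i. h * z $ i \<le> x $ i \<and> x $ i < h * z $ i + h)"
  using assms by (simp add: grid_cell_def floor_eq_iff field_simps)

lemma measure_grid_cell:
  fixes z :: "int ^ 'n" and h :: real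
  assumes h: "0 < h"
  shows "grid_cell h z \<in> lmeasurable" "measure lebesgue (grid_cell h z) = h ^ CARD('n)"
proof -
  let ?a = "(\<chi> i. h * z $ i) :: real ^ 'n" and ?b = "(\<chi> i. h * z $ i + h) :: real ^ 'n"
  \<comment> \<open>The half-open cube is squeezed between an open and a closed box of equal
    volume.\<close>
  have sub: "box ?a ?b \<subseteq> grid_cell h z" "grid_cell h z \<subseteq> cbox ?a ?b"
    by (auto simp: grid_cell_iff[OF h] mem_box_cart less_imp_le)
  have [measurable]: "grid_cell h z \<in> sets lebesgue"
    using grid_cell_borel by (simp add: sets_completionI_sets)
  show 1: "grid_cell h z \<in> lmeasurable"
    using sub(2) by (rule fmeasurableI2[rotated]) auto
  have c: "measure lebesgue (cbox ?a ?b) = h ^ CARD('n)"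
    using h by (simp add: measure_completion content_cbox_if_cart interval_eq_empty_cart not_less)
  have "measure lebesgue (cbox ?a ?b) = measure lebesgue (box ?a ?b)"
    by (simp add: measure_completion measure_def emeasure_lborel_box_eq emeasure_lborel_cbox_eq)
  moreover have "measure lebesgue (box ?a ?b) \<le> measure lebesgue (grid_cell h z)"
    by (rule measure_mono_fmeasurable[OF sub(1) _ 1]) simp
  moreover have "measure lebesgue (grid_cell h z) \<le> measure lebesgue (cbox ?a ?b)"
    by (rule measure_mono_fmeasurable[OF sub(2)]) (use 1 in auto)
  ultimately show "measure lebesgue (grid_cell h z) = h ^ CARD('n)"
    using c by linarith
qed

lemma norm_diff_grid_cell_le:
  fixes z :: "int ^ 'n" and h :: real
  assumes h: "0 < h" and "x \<in> grid_cell h z" "y \<in> grid_cell h z"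
  shows "norm (x - y) \<le> CARD('n) * h"
proof -
  have "norm (x - y) \<le> (\<Sum>i\<in>UNIV. \<bar>(x - y) $ i\<bar>)" by (rule norm_le_l1_cart)
  also have "\<dots> \<le> (\<Sum>i\<in>(UNIV::'n set). h)"
  proof (rule sum_mono)
    fix i
    have "h * z $ i \<le> x $ i" "x $ i < h * z $ i + h" "h * z $ i \<le> y $ i" "y $ i < h * z $ i + h"
      using assms by (auto simp: grid_cell_iff)
    then show "\<bar>(x - y) $ i\<bar> \<le> h" by (simp add: abs_le_iff)
  qed
  finally show ?thesis by simp
qed

text \<open>This lets finitely many cell masses control what happens inside a ball.\<close>

lemma finite_grid_cell_bounded:
  fixes S :: "(real ^ 'n) set" and h :: real
  assumes h: "0 < h" and "bounded S"
  shows "finite {z. grid_cell h z \<inter> S \<noteq> {}}"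
proof -
  obtain R where R: "\<And>x. x \<in> S \<Longrightarrow> norm x \<le> R" using assms(2) by (auto simp: bounded_iff)
  let ?F = "PiE (UNIV::'n set) (\<lambda>_. {\<lfloor>- R / h\<rfloor>..\<lfloor>R / h\<rfloor>})"
  have "{z. grid_cell h z \<inter> S \<noteq> {}} \<subseteq> vec_lambda ` ?F"
  proof
    fix z assume "z \<in> {z. grid_cell h z \<inter> S \<noteq> {}}"
    then obtain x where x: "x \<in> S" "\<And>i. \<lfloor>x $ i / h\<rfloor> = z $ i" by (auto simp: grid_cell_def)
    have "- R \<le> x $ i \<and> x $ i \<le> R" for i
      using component_le_norm_cart[of x i] R[OF x(1)] by auto
    then have "- R / h \<le> x $ i / h \<and> x $ i / h \<le> R / h" for i
      using h divide_right_mono[of "- R" "x $ i" h] divide_right_mono[of "x $ i" R h] by simp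
    then have "\<lfloor>- R / h\<rfloor> \<le> z $ i \<and> z $ i \<le> \<lfloor>R / h\<rfloor>" for i
      unfolding x(2)[symmetric] by (auto intro: floor_mono)
    then have "vec_nth z \<in> ?F" by auto
    then show "z \<in> vec_lambda ` ?F" by (metis imageI vec_nth_inverse)
  qed
  then show ?thesis by (rule finite_subset) (intro finite_imageI finite_PiE; simp)
qed

section \<open>The perimeter controls mixing inside the cells\<close>

text \<open>Only pairs \<open>y\<close> in \<open>E\<close>, \<open>x\<close> outside
  \<open>E\<close> from a common cell are kept in the double integral. Their distance is at most
  \<open>CARD('n) * h\<close>, so the kernel is at least its value at that distance.\<close>

lemma sum_grid_cell_le_frac_perimeter:
  fixes E :: "(real ^ 'n) set" and h s :: real
  assumes h: "0 < h" and s: "0 < s" and K: "finite K" and E [measurable]: "E \<in> sets lebesgue"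
  shows "(\<Sum>z\<in>K. emeasure lebesgue (E \<inter> grid_cell h z) * emeasure lebesgue (grid_cell h z - E))
      * ennreal (1 / (CARD('n) * h) powr (CARD('n) + s)) \<le> frac_perimeter s E"
proof -
  let ?c = "ennreal (1 / (CARD('n) * h) powr (CARD('n) + s))" and ?Q = "grid_cell h"
  have [measurable]: "?Q z \<in> sets lebesgue" for z :: "int ^ 'n"
    using grid_cell_borel by (simp add: sets_completionI_sets)
  have "(\<Sum>z\<in>K. emeasure lebesgue (E \<inter> ?Q z) * emeasure lebesgue (?Q z - E)) * ?c
      = (\<Sum>z\<in>K. \<integral>\<^sup>+y. (?c * emeasure lebesgue (?Q z - E)) * indicator (E \<inter> ?Q z) y \<partial>lebesgue)"
    unfolding sum_distrib_right
    by (intro sum.cong refl, subst nn_integral_cmult) (simp_all add: mult_ac del: emeasure_completion)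
  also have "\<dots> = (\<integral>\<^sup>+y. (\<Sum>z\<in>K. (?c * emeasure lebesgue (?Q z - E)) * indicator (E \<inter> ?Q z) y) \<partial>lebesgue)"
    by (rule nn_integral_sum[symmetric]) auto
  also have "\<dots> \<le> frac_perimeter s E"
    unfolding frac_perimeter_def
  proof (rule nn_integral_mono)
    fix y :: "real ^ 'n"
    let ?f = "\<lambda>z. (?c * emeasure lebesgue (?Q z - E)) * indicator (E \<inter> ?Q z) y"
    let ?J = "\<integral>\<^sup>+x\<in>- E. frac_kernel s x y \<partial>lebesgue"
    show "(\<Sum>z\<in>K. ?f z) \<le> ?J * indicator E y"
    proof (cases "\<exists>z\<in>K. y \<in> E \<inter> ?Q z")
      case False
      then have "(\<Sum>z\<in>K. ?f z) = 0" by (intro sum.neutral) auto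
      then show ?thesis by simp
    next
      case True
      then obtain w where w: "w \<in> K" "y \<in> E" "y \<in> ?Q w" by auto
      \<comment> \<open>The cells are disjoint, so only the one containing \<open>y\<close>
        contributes.\<close>
      have "(\<Sum>z\<in>K. ?f z) = (\<Sum>z\<in>{w}. ?f z)"
        using w grid_cell_disjoint by (intro sum.mono_neutral_right K) (auto simp: indicator_def)
      also have "\<dots> = (\<integral>\<^sup>+x. ?c * indicator (?Q w - E) x \<partial>lebesgue)"
        using w by (simp add: nn_integral_cmult del: emeasure_completion)
      also have "\<dots> \<le> ?J"
      proof (rule nn_integral_mono)
        fix x
        show "?c * indicator (?Q w - E) x \<le> frac_kernel s x y * indicator (- E) x"
        proof (cases "x \<in> ?Q w - E")
          case True
          \<comment> \<open>\<open>x\<close> lies outside \<open>E\<close> and \<open>y\<close>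
            inside, so they differ. On the diagonal, division by zero gives the kernel the value 0
            and the lower bound would fail.\<close>
          then have "0 < norm (x - y)" "norm (x - y) \<le> CARD('n) * h"
            using w norm_diff_grid_cell_le[OF h] by auto
          then have "1 / (CARD('n) * h) powr (CARD('n) + s) \<le> 1 / norm (x - y) powr (CARD('n) + s)"
            using s by (intro divide_left_mono powr_mono2) (auto intro!: mult_pos_pos)
          then show ?thesis using True by (auto intro!: ennreal_leI)
        qed simp
      qed
      finally show ?thesis using w by simp
    qed
  qed
  finally show ?thesis .
qed

lemma sum_measure_grid_cell_le:
  fixes E :: "(real ^ 'n) set" and h s :: real
  assumes h: "0 < h" and s: "0 < s" and K: "finite K" and E: "E \<in> sets lebesgue"
    and C: "frac_perimeter s E \<le> ennreal C" "0 \<le> C"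
  shows "(\<Sum>z\<in>K. measure lebesgue (E \<inter> grid_cell h z) * measure lebesgue (grid_cell h z - E))
    \<le> C * (CARD('n) * h) powr (CARD('n) + s)"
proof -
  let ?Q = "grid_cell h" and ?c = "(CARD('n) * h) powr (CARD('n) + s)"
  have Q: "?Q z \<in> lmeasurable" for z :: "int ^ 'n" by (rule measure_grid_cell[OF h])
  have "E \<inter> ?Q z \<in> lmeasurable" "?Q z - E \<in> lmeasurable" for z
    using fmeasurable_Int_fmeasurable[OF Q E] fmeasurable_Diff[OF Q E] by (auto simp: Int_commute)
  then have eq: "emeasure lebesgue (E \<inter> ?Q z) * emeasure lebesgue (?Q z - E)
      = ennreal (measure lebesgue (E \<inter> ?Q z) * measure lebesgue (?Q z - E))" for z
    by (simp add: emeasure_eq_measure2 ennreal_mult del: emeasure_completion)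
  have c: "0 < ?c" using h by simp
  let ?S = "\<Sum>z\<in>K. measure lebesgue (E \<inter> ?Q z) * measure lebesgue (?Q z - E)"
  have "ennreal (?S * (1 / ?c))
      = (\<Sum>z\<in>K. emeasure lebesgue (E \<inter> ?Q z) * emeasure lebesgue (?Q z - E)) * ennreal (1 / ?c)"
    unfolding eq using c by (subst ennreal_mult) (auto intro!: sum_nonneg)
  also have "\<dots> \<le> ennreal C"
    using sum_grid_cell_le_frac_perimeter[OF h s K E] C(1) by (rule order_trans)
  finally have "?S * (1 / ?c) \<le> C" using C(2) by simp
  then show ?thesis using c by (simp add: field_simps)
qed

text \<open>The cell inequality is summed over \<open>K\<close>. The perimeter bound contributes the
  power \<open>CARD('n) + s\<close> of the mesh, and division by the cell volume leaves
  \<open>h powr s\<close>, which vanishes with the mesh.\<close>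

lemma measure_symm_diff_grid_le:
  fixes A B :: "(real ^ 'n) set" and h s :: real
  assumes h: "0 < h" and s: "0 < s" and K: "finite K"
    and A: "A \<in> sets lebesgue" "frac_perimeter s A \<le> ennreal C"
    and B: "B \<in> sets lebesgue" "frac_perimeter s B \<le> ennreal C" and C: "0 \<le> C"
  shows "measure lebesgue (sym_diff A B \<inter> (\<Union>z\<in>K. grid_cell h z))
    \<le> 4 * C * CARD('n) powr (CARD('n) + s) * h powr s
      + (\<Sum>z\<in>K. \<bar>measure lebesgue (A \<inter> grid_cell h z) - measure lebesgue (B \<inter> grid_cell h z)\<bar>)"
proof -
  let ?Q = "grid_cell h" and ?\<mu> = "measure lebesgue"
  let ?v = "\<lambda>A z. ?\<mu> (A \<inter> ?Q z) * ?\<mu> (?Q z - A)"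
  have "?\<mu> (sym_diff A B \<inter> (\<Union>z\<in>K. ?Q z)) = ?\<mu> (\<Union>z\<in>K. sym_diff A B \<inter> ?Q z)"
    by (simp only: Int_UN_distrib)
  also have "\<dots> \<le> (\<Sum>z\<in>K. ?\<mu> (sym_diff A B \<inter> ?Q z))"
  proof (rule measure_UNION_le[OF K])
    fix z show "sym_diff A B \<inter> ?Q z \<in> sets lebesgue"
      using A(1) B(1) measure_grid_cell(1)[OF h, of z] by (auto intro: fmeasurableD)
  qed
  also have "\<dots> \<le> (\<Sum>z\<in>K. 2 * (?v A z + ?v B z) / h ^ CARD('n) + \<bar>?\<mu> (A \<inter> ?Q z) - ?\<mu> (B \<inter> ?Q z)\<bar>)"
  proof (rule sum_mono)
    fix z
    show "?\<mu> (sym_diff A B \<inter> ?Q z)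
        \<le> 2 * (?v A z + ?v B z) / h ^ CARD('n) + \<bar>?\<mu> (A \<inter> ?Q z) - ?\<mu> (B \<inter> ?Q z)\<bar>"
      using measure_symm_diff_Int_cell_le[OF A(1) B(1) measure_grid_cell(1)[OF h, of z]] h
      by (simp add: measure_grid_cell(2)[OF h] del: measure_completion)
  qed
  also have "\<dots> = 2 * (sum (?v A) K + sum (?v B) K) / h ^ CARD('n)
      + (\<Sum>z\<in>K. \<bar>?\<mu> (A \<inter> ?Q z) - ?\<mu> (B \<inter> ?Q z)\<bar>)"
    by (simp only: sum.distrib flip: sum_distrib_left sum_divide_distrib)
  \<comment> \<open>The factor 2 of the cell inequality and one bound \<open>C\<close> for each of
    the two sets make up the constant 4.\<close>
  also have "2 * (sum (?v A) K + sum (?v B) K) / h ^ CARD('n)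
      \<le> 2 * (C * (CARD('n) * h) powr (CARD('n) + s) + C * (CARD('n) * h) powr (CARD('n) + s)) / h ^ CARD('n)"
    using h by (intro divide_right_mono mult_left_mono add_mono sum_measure_grid_cell_le assms) auto
  also have "\<dots> = 4 * C * CARD('n) powr (CARD('n) + s) * h powr s"
    using h by (simp add: powr_mult powr_add powr_realpow field_simps)
  finally show ?thesis by simp
qed

section \<open>Compactness in measure\<close>

text \<open>Inside a large ball the sets are controlled by their masses in finitely many cells of a
  fine grid; \<open>tight\<close> controls what lies outside the ball.\<close>

lemma bounded_frac_perimeter_Cauchy_subsequence:
  fixes E :: "nat \<Rightarrow> (real ^ 'n) set" and s C :: real
  assumes s: "0 < s" and E: "\<And>n. E n \<in> lmeasurable" and m: "\<And>n. measure lebesgue (E n) \<le> m"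
    and C: "\<And>n. frac_perimeter s (E n) \<le> ennreal C" "0 \<le> C"
    and tight: "\<And>e. 0 < e \<Longrightarrow> \<exists>R. \<forall>n. measure lebesgue (E n - cball 0 R) \<le> e"
  obtains k :: "nat \<Rightarrow> nat" where "strict_mono k"
    "\<And>e. 0 < e \<Longrightarrow> \<exists>N. \<forall>n\<ge>N. \<forall>p\<ge>N. measure lebesgue (sym_diff (E (k n)) (E (k p))) < e"
proof -
  let ?\<mu> = "measure lebesgue :: (real ^ 'n) set \<Rightarrow> real"
  let ?Q = "\<lambda>(j, z). grid_cell (inverse (Suc j)) (z :: int ^ 'n)"
  have Es [measurable]: "E n \<in> sets lebesgue" for n using E by auto
  have Qs [measurable]: "grid_cell h (z :: int ^ 'n) \<in> sets lebesgue" for h z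
    using grid_cell_borel by (simp add: sets_completionI_sets)
  have bd: "norm (?\<mu> (E n \<inter> ?Q i)) \<le> m" for n i
  proof -
    have "?\<mu> (E n \<inter> ?Q i) \<le> ?\<mu> (E n)"
      by (rule measure_mono_fmeasurable[OF _ _ E]) (auto split: prod.split)
    then show ?thesis using m[of n] by (simp del: measure_completion)
  qed
  \<comment> \<open>Meshes and cells together form a countable index set, so a diagonal argument
    makes the masses converge on every grid along one subsequence. The mesh can therefore be chosen
    after \<open>e\<close>.\<close>
  obtain k :: "nat \<Rightarrow> nat" where k: "strict_mono k" "\<And>i. \<exists>l. (\<lambda>n. ?\<mu> (E (k n) \<inter> ?Q i)) \<longlonglongrightarrow> l"
    by (rule function_convergent_subsequence[of UNIV "\<lambda>n i. ?\<mu> (E n \<inter> ?Q i)" m])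
      (use bd in \<open>blast intro: countableI_type\<close>)+
  show thesis
  proof (rule that[OF k(1)])
    fix e :: real assume "0 < e"
    \<comment> \<open>The two tails cost \<open>e / 8\<close> each, the \<open>h powr s\<close> term
      and the differences of masses \<open>e / 4\<close> each, in total less than
      \<open>e\<close>.\<close>
    then obtain R where R: "\<And>n. ?\<mu> (E n - cball 0 R) \<le> e / 8"
      using tight[of "e / 8"] by auto
    define c where "c = 4 * C * CARD('n) powr (CARD('n) + s)"
    have "(\<lambda>j. c * inverse (real (Suc j)) powr s) \<longlonglongrightarrow> c * 0"
      using tendsto_neg_powr[OF _ filterlim_real_sequentially, of "- s"] s
      by (intro tendsto_intros) real_asymp
    then have "eventually (\<lambda>j. c * inverse (real (Suc j)) powr s < e / 4) sequentially"
      using \<open>0 < e\<close> by (intro order_tendstoD(2)) auto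
    then obtain j where j: "c * inverse (real (Suc j)) powr s < e / 4"
      by (auto simp: eventually_sequentially)
    define h where "h = inverse (real (Suc j))"
    have h: "0 < h" by (simp add: h_def)
    define K where "K = {z :: int ^ 'n. grid_cell h z \<inter> cball 0 R \<noteq> {}}"
    have K: "finite K" unfolding K_def by (intro finite_grid_cell_bounded h bounded_cball)
    have "Cauchy (\<lambda>n. ?\<mu> (E (k n) \<inter> grid_cell h z))" for z
      using k(2)[of "(j, z)"] by (auto simp: h_def convergent_eq_Cauchy[symmetric] convergent_def)
    \<comment> \<open>The summand 1 covers empty \<open>K\<close>, where division by
      \<open>card K\<close> would give 0 and no strict bound could hold.\<close>
    then have "\<exists>N. \<forall>n\<ge>N. \<forall>p\<ge>N. \<bar>?\<mu> (E (k n) \<inter> grid_cell h z) - ?\<mu> (E (k p) \<inter> grid_cell h z)\<bar>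
        < e / (4 * (1 + card K))" for z
      using \<open>0 < e\<close> by (auto simp: Cauchy_def dist_real_def)
    then obtain N where N: "\<And>z n p. N z \<le> n \<Longrightarrow> N z \<le> p \<Longrightarrow>
        \<bar>?\<mu> (E (k n) \<inter> grid_cell h z) - ?\<mu> (E (k p) \<inter> grid_cell h z)\<bar> < e / (4 * (1 + card K))"
      by metis
    show "\<exists>N. \<forall>n\<ge>N. \<forall>p\<ge>N. ?\<mu> (sym_diff (E (k n)) (E (k p))) < e"
    proof (intro exI allI impI)
      fix n p assume n: "sum N K \<le> n" and p: "sum N K \<le> p"
      let ?A = "E (k n)" and ?B = "E (k p)"
      have NK: "N z \<le> sum N K" if "z \<in> K" for z
        using that K by (simp add: member_le_sum)
      have "(\<Sum>z\<in>K. \<bar>?\<mu> (?A \<inter> grid_cell h z) - ?\<mu> (?B \<inter> grid_cell h z)\<bar>)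
          \<le> (\<Sum>z\<in>K. e / (4 * (1 + card K)))"
        using N NK n p by (intro sum_mono less_imp_le) (meson order_trans)
      also have "\<dots> \<le> e / 4"
        using \<open>0 < e\<close> by (simp add: field_simps)
      finally have 1: "?\<mu> (sym_diff ?A ?B \<inter> (\<Union>z\<in>K. grid_cell h z)) < e / 2"
        using measure_symm_diff_grid_le[OF h s K Es C(1) Es C(1) C(2), of "k n" "k p"] j
        unfolding h_def[symmetric] c_def[symmetric] by linarith
      have cov: "cball 0 R \<subseteq> (\<Union>z\<in>K. grid_cell h z)"
        using mem_grid_cell by (fastforce simp: K_def)
      let ?U = "sym_diff ?A ?B \<inter> (\<Union>z\<in>K. grid_cell h z)"
      have fm: "E i - cball 0 R \<in> lmeasurable" "sym_diff (E i) (E l) \<in> lmeasurable" for i l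
        using E by (auto intro: fmeasurable_Diff)
      \<comment> \<open>The cells of \<open>K\<close> cover the ball, so whatever lies outside these
        cells lies outside the ball.\<close>
      have "?\<mu> (sym_diff ?A ?B) \<le> ?\<mu> (?U \<union> ((?A - cball 0 R) \<union> (?B - cball 0 R)))"
        using cov K by (intro measure_mono_fmeasurable fmeasurable.Un fm fmeasurable_Int_fmeasurable) auto
      also have "\<dots> \<le> ?\<mu> ?U + (?\<mu> (?A - cball 0 R) + ?\<mu> (?B - cball 0 R))"
        by (intro order_trans[OF measure_Un_le] add_left_mono measure_Un_le sets.Un fmeasurableD[OF fm(1)]
            order_refl sets.Int fmeasurableD[OF fm(2)] sets.finite_UN K Qs)
      finally show "?\<mu> (sym_diff ?A ?B) < e"
        using 1 R[of "k n"] R[of "k p"] \<open>0 < e\<close> by linarith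
    qed
  qed
qed

section \<open>Limits of sequences of sets that are Cauchy in measure\<close>

text \<open>Fatou for indicator functions.\<close>

lemma emeasure_le_liminf_of_AE_lim:
  assumes [measurable]: "\<And>n. E n \<in> sets M" "A \<in> sets M"
    and lim: "AE x in M. eventually (\<lambda>n. x \<in> E n \<longleftrightarrow> x \<in> A) sequentially"
  shows "emeasure M A \<le> liminf (\<lambda>n. emeasure M (E n))"
proof -
  have "emeasure M A = (\<integral>\<^sup>+x. liminf (\<lambda>n. indicator (E n) x) \<partial>M)"
    unfolding nn_integral_indicator[OF assms(2), symmetric]
  proof (rule nn_integral_cong_AE, use lim in eventually_elim)
    case (elim x)
    have "(\<lambda>n. indicator (E n) x :: ennreal) \<longlonglongrightarrow> indicator A x"
      by (rule tendsto_eventually) (use elim in eventually_elim, auto simp: indicator_def)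
    then show ?case by (simp add: lim_imp_Liminf)
  qed
  also have "\<dots> \<le> liminf (\<lambda>n. \<integral>\<^sup>+x. indicator (E n) x \<partial>M)"
    by (rule nn_integral_liminf) measurable
  finally show ?thesis by simp
qed

text \<open>Along a fast subsequence the consecutive symmetric differences have summable measure. By
  Borel-Cantelli almost every point lies in finitely many of them, so its membership is eventually
  constant.\<close>

lemma Cauchy_sets_AE_subsequence:
  fixes E :: "nat \<Rightarrow> 'a set"
  assumes E: "\<And>n. E n \<in> fmeasurable M"
    and Cauchy: "\<And>e. 0 < e \<Longrightarrow> \<exists>N. \<forall>n\<ge>N. \<forall>p\<ge>N. measure M (sym_diff (E n) (E p)) < e"
  obtains r :: "nat \<Rightarrow> nat" and A where "strict_mono r" "A \<in> sets M"
    "AE x in M. eventually (\<lambda>n. x \<in> E (r n) \<longleftrightarrow> x \<in> A) sequentially"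
proof -
  have [measurable]: "E n \<in> sets M" for n using E by auto
  have "\<exists>N. \<forall>n\<ge>N. \<forall>p\<ge>N. measure M (sym_diff (E n) (E p)) < (1/2) ^ i" for i :: nat
    by (rule Cauchy) simp
  then obtain N where N: "\<And>i n p. N i \<le> n \<Longrightarrow> N i \<le> p \<Longrightarrow> measure M (sym_diff (E n) (E p)) < (1/2) ^ i"
    by metis
  \<comment> \<open>The summand \<open>i\<close> makes \<open>r\<close> strictly increasing; the sum
    dominates \<open>N i\<close> at both \<open>r i\<close> and \<open>r (Suc i)\<close>.\<close>
  define r where "r i = i + sum N {..i}" for i
  have r: "strict_mono r" by (auto simp: strict_mono_Suc_iff r_def)
  have rN: "N i \<le> r i" "N i \<le> r (Suc i)" for i
    using member_le_sum[of i "{..i}" N] by (auto simp: r_def)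
  let ?D = "\<lambda>i. sym_diff (E (r i)) (E (r (Suc i)))"
  have fm: "?D i \<in> fmeasurable M" for i using E by (auto intro: fmeasurable_Diff)
  have AE: "AE x in M. eventually (\<lambda>i. x \<in> space M - ?D i) sequentially"
  proof (rule borel_cantelli_AE1)
    show "emeasure M (?D i) < \<infinity>" for i using fm by (simp add: fmeasurable_def)
    show "summable (\<lambda>i. measure M (?D i))"
      by (rule summable_comparison_test'[of "\<lambda>i. (1/2) ^ i" 0])
        (use N[OF rN] in \<open>auto intro: less_imp_le\<close>)
  qed auto
  \<comment> \<open>The set-theoretic limit inferior, which agrees with the eventual membership
    wherever the latter exists.\<close>
  define A where "A = (\<Union>n. \<Inter>i\<in>{n..}. E (r i))"
  have *: "eventually (\<lambda>n. x \<in> E (r n) \<longleftrightarrow> x \<in> A) sequentially"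
    if ev: "eventually (\<lambda>i. x \<in> space M - ?D i) sequentially" for x
  proof -
    obtain n where n: "\<And>i. n \<le> i \<Longrightarrow> x \<in> E (r i) \<longleftrightarrow> x \<in> E (r (Suc i))"
      using ev by (auto simp: eventually_sequentially)
    have const: "x \<in> E (r i) \<longleftrightarrow> x \<in> E (r n)" if "n \<le> i" for i
      using that
    proof (induction i rule: dec_induct)
      case (step l)
      then show ?case using n[of l] by blast
    qed simp
    have "x \<in> A \<longleftrightarrow> x \<in> E (r n)"
    proof
      assume "x \<in> A"
      then obtain l where "\<And>i. l \<le> i \<Longrightarrow> x \<in> E (r i)" by (auto simp: A_def)
      then have "x \<in> E (r (max l n))" by simp
      then show "x \<in> E (r n)" using const[of "max l n"] by simp
    next
      assume "x \<in> E (r n)"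
      then show "x \<in> A" using const unfolding A_def by blast
    qed
    then show ?thesis using const unfolding eventually_sequentially by blast
  qed
  have "AE x in M. eventually (\<lambda>n. x \<in> E (r n) \<longleftrightarrow> x \<in> A) sequentially"
    using AE by eventually_elim (rule *)
  moreover have "A \<in> sets M" unfolding A_def by measurable
  ultimately show thesis using that r by blast
qed

text \<open>Fatou alone gives only \<open>emeasure M A \<le> c\<close>. The Cauchy property excludes
  a loss of mass in the limit: for large \<open>n\<close>, only a small part of \<open>E n\<close>
  lies outside \<open>A\<close>.\<close>

lemma emeasure_AE_lim_Cauchy_sets:
  fixes E :: "nat \<Rightarrow> 'a set"
  assumes E: "\<And>n. E n \<in> fmeasurable M" and A [measurable]: "A \<in> sets M"
    and Cauchy: "\<And>e. 0 < e \<Longrightarrow> \<exists>N. \<forall>n\<ge>N. \<forall>p\<ge>N. measure M (sym_diff (E n) (E p)) < e"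
    and lim: "AE x in M. eventually (\<lambda>n. x \<in> E n \<longleftrightarrow> x \<in> A) sequentially"
    and c: "\<And>n. emeasure M (E n) = c"
  shows "emeasure M A = c"
proof (rule antisym)
  have Es [measurable]: "E n \<in> sets M" for n using E by auto
  show "emeasure M A \<le> c"
    using emeasure_le_liminf_of_AE_lim[OF Es A lim] by (simp add: c Liminf_const)
  show "c \<le> emeasure M A"
  proof (rule ennreal_le_epsilon)
    fix e :: real assume "0 < e"
    then obtain n where n: "\<And>p. n \<le> p \<Longrightarrow> measure M (sym_diff (E n) (E p)) < e"
      using Cauchy by blast
    \<comment> \<open>Here \<open>n\<close> stays fixed while \<open>p\<close> tends to
      infinity.\<close>
    have "emeasure M (E n - A) \<le> liminf (\<lambda>p. emeasure M (E n - E p))"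
    proof (rule emeasure_le_liminf_of_AE_lim)
      show "AE x in M. eventually (\<lambda>p. x \<in> E n - E p \<longleftrightarrow> x \<in> E n - A) sequentially"
        using lim by eventually_elim (auto elim: eventually_mono)
    qed auto
    also have "\<dots> \<le> liminf (\<lambda>p. ennreal e)"
    proof (rule Liminf_mono, rule eventually_sequentiallyI)
      fix p assume "n \<le> p"
      have fm: "sym_diff (E n) (E p) \<in> fmeasurable M" using E by (auto intro: fmeasurable_Diff)
      have "emeasure M (E n - E p) \<le> emeasure M (sym_diff (E n) (E p))"
        by (intro emeasure_mono) auto
      also have "\<dots> \<le> ennreal e"
        using n[OF \<open>n \<le> p\<close>] fm by (simp add: emeasure_eq_measure2 ennreal_leI)
      finally show "emeasure M (E n - E p) \<le> ennreal e" .
    qed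
    finally have small: "emeasure M (E n - A) \<le> ennreal e" by (simp add: Liminf_const)
    have "c \<le> emeasure M (A \<union> (E n - A))"
      unfolding c[of n, symmetric] by (intro emeasure_mono) auto
    also have "\<dots> \<le> emeasure M A + emeasure M (E n - A)"
      by (intro emeasure_subadditive) auto
    also have "\<dots> \<le> emeasure M A + ennreal e" using small by (rule add_left_mono)
    finally show "c \<le> emeasure M A + ennreal e" .
  qed
qed

section \<open>Nonempty competitor class, tightness and the minimizer\<close>

lemma exists_lebesgue_set_emeasure:
  assumes "0 \<le> m"
  obtains E :: "(real ^ 'n) set" where "E \<in> sets lebesgue" "emeasure lebesgue E = ennreal m"
proof -
  define l where "l = root CARD('n) m"
  have l: "0 \<le> l" "l ^ CARD('n) = m" using assms by (auto simp: l_def)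
  let ?E = "cbox 0 (\<chi> i. l) :: (real ^ 'n) set"
  have "measure lebesgue ?E = m"
    using l by (simp add: content_cbox_if_cart interval_eq_empty_cart not_less)
  then have "emeasure lebesgue ?E = ennreal m"
    by (subst emeasure_eq_measure2) auto
  then show thesis by (intro that[of ?E]) auto
qed

text \<open>Chebyshev: outside a large ball \<open>M - g\<close> is at least \<open>t\<close>, so a
  set with potential at most \<open>C\<close> has measure at most \<open>C / t\<close> there. The
  radius is the same for all such sets.\<close>

lemma coercive_potential_tight:
  fixes g :: "'a::euclidean_space \<Rightarrow> real"
  assumes g [measurable]: "g \<in> borel_measurable lebesgue" and lim: "filterlim g at_bot at_infinity"
    and C: "0 \<le> C" and "0 < e"
  obtains R where "\<And>E. E \<in> lmeasurable \<Longrightarrow> (\<integral>\<^sup>+x\<in>E. ennreal (M - g x) \<partial>lebesgue) \<le> ennreal C \<Longrightarrow>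
    measure lebesgue (E - cball 0 R) \<le> e"
proof -
  \<comment> \<open>\<open>C + 1\<close> in place of \<open>C\<close> keeps \<open>t\<close>
    positive when \<open>C = 0\<close>, and \<open>C / t \<le> e\<close> still holds.\<close>
  define t where "t = (C + 1) / e"
  have t: "0 < t" using C \<open>0 < e\<close> by (simp add: t_def)
  have "eventually (\<lambda>x. g x \<le> M - t) at_infinity"
    using lim by (simp add: filterlim_at_bot)
  then obtain R where R: "\<And>x. R \<le> norm x \<Longrightarrow> g x \<le> M - t"
    by (auto simp: eventually_at_infinity)
  show thesis
  proof (rule that)
    fix E assume E: "E \<in> lmeasurable" and le: "(\<integral>\<^sup>+x\<in>E. ennreal (M - g x) \<partial>lebesgue) \<le> ennreal C"
    have fm: "E - cball 0 R \<in> lmeasurable" using E by (auto intro: fmeasurable_Diff)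
    have "ennreal (t * measure lebesgue (E - cball 0 R)) = (\<integral>\<^sup>+x. ennreal t * indicator (E - cball 0 R) x \<partial>lebesgue)"
      using fm t by (subst nn_integral_cmult_indicator) (auto simp: emeasure_eq_measure2 ennreal_mult simp del: emeasure_completion measure_completion)
    also have "\<dots> \<le> (\<integral>\<^sup>+x\<in>E. ennreal (M - g x) \<partial>lebesgue)"
    proof (rule nn_integral_mono)
      fix x
      show "ennreal t * indicator (E - cball 0 R) x \<le> ennreal (M - g x) * indicator E x"
        using R[of x] by (auto simp: indicator_def intro!: ennreal_leI)
    qed
    also note le
    finally have "t * measure lebesgue (E - cball 0 R) \<le> C"
      using ennreal_le_iff[OF C] by blast
    then have "measure lebesgue (E - cball 0 R) \<le> C / t" using t by (simp add: field_simps)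
    also have "\<dots> \<le> e" using C \<open>0 < e\<close> by (simp add: t_def field_simps)
    finally show "measure lebesgue (E - cball 0 R) \<le> e" .
  qed
qed

theorem proposition5p3:
  fixes s m :: real and g :: "real ^ 'n \<Rightarrow> real"
  assumes "0 < s" and "s < 1"
    and "g \<in> borel_measurable lebesgue"
    and "bdd_above (range g)"
    and "filterlim g at_bot at_infinity"
    and "0 < m"
  shows "\<exists>E. is_arg_min (energy s g)
               (\<lambda>E. E \<in> sets lebesgue \<and> emeasure lebesgue E = ennreal m) E"
proof -
  note g [measurable] = assms(3)
  obtain M0 where M0: "\<And>x. g x \<le> M0" using assms(4) by (auto simp: bdd_above_def)
  \<comment> \<open>The maximum with 0 supplies the nonnegative upper bound that
    \<open>energy_eq\<close> asks for.\<close>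
  define M where "M = max 0 M0"
  have M: "\<And>x. g x \<le> M" "0 \<le> M" using M0 by (auto simp: M_def le_max_iff_disj)
  define Adm where "Adm = {E :: (real ^ 'n) set. E \<in> sets lebesgue \<and> emeasure lebesgue E = ennreal m}"
  define F where "F E = frac_perimeter s E + (\<integral>\<^sup>+x\<in>E. ennreal (M - g x) \<partial>lebesgue)" for E
  have energy: "energy s g E = enn2ereal (F E) - ereal (M * m)" if "E \<in> Adm" for E
    using that energy_eq[OF _ _ _ g M, of E m s] assms(6) by (simp add: Adm_def F_def)
  obtain E0 where E0: "E0 \<in> Adm"
    using exists_lebesgue_set_emeasure[OF less_imp_le[OF assms(6)]] unfolding Adm_def by blast
  have "\<exists>E\<in>Adm. F E \<le> Inf (F ` Adm)"
  proof (cases "Inf (F ` Adm) = top")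
    \<comment> \<open>Every admissible set has infinite \<open>F\<close> in this case, so any of
      them is a minimizer.\<close>
    case True
    then show ?thesis using E0 by auto
  next
    case False
    then obtain I where I: "Inf (F ` Adm) = ennreal I" "0 \<le> I" by (cases "Inf (F ` Adm)") auto
    obtain u where u: "\<And>n. u n \<in> F ` Adm" "u \<longlonglongrightarrow> ennreal I"
      using Inf_as_limit[of "F ` Adm"] E0 I(1) by auto
    \<comment> \<open>On a tail \<open>F\<close> stays below \<open>I + 1\<close>; the shift by
      \<open>n0\<close> makes this bound hold for every index.\<close>
    have "eventually (\<lambda>n. u n < ennreal (I + 1)) sequentially"
      using u(2) by (rule order_tendstoD) (simp add: I ennreal_less_iff)
    then obtain n0 where n0: "\<And>n. n0 \<le> n \<Longrightarrow> u n < ennreal (I + 1)"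
      by (auto simp: eventually_sequentially)
    have "\<exists>E. E \<in> Adm \<and> F E = u (n + n0)" for n
      using u(1)[of "n + n0"] by (metis imageE)
    then obtain E where E: "\<And>n. E n \<in> Adm" "\<And>n. F (E n) = u (n + n0)" by metis
    have FE: "F (E n) \<le> ennreal (I + 1)" for n using n0[of "n + n0"] E(2)[of n] by simp
    have F_lim: "(\<lambda>n. F (E n)) \<longlonglongrightarrow> ennreal I"
      unfolding E(2) using u(2) by (rule LIMSEQ_ignore_initial_segment)
    have Em: "E n \<in> lmeasurable" "emeasure lebesgue (E n) = ennreal m" "measure lebesgue (E n) \<le> m" for n
      using E(1)[of n] assms(6) by (auto simp: Adm_def fmeasurable_def measure_def simp del: emeasure_completion measure_completion)
    \<comment> \<open>Both terms of \<open>F\<close> are nonnegative, so each inherits the bound: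
      the first serves local compactness, the second tightness.\<close>
    have P: "frac_perimeter s (E n) \<le> ennreal (I + 1)"
      and G: "(\<integral>\<^sup>+x\<in>E n. ennreal (M - g x) \<partial>lebesgue) \<le> ennreal (I + 1)" for n
      using FE[of n] by (auto simp: F_def intro: order_trans[rotated])
    have I1: "0 \<le> I + 1" using I by simp
    have tight: "\<exists>R. \<forall>n. measure lebesgue (E n - cball 0 R) \<le> e" if e: "0 < e" for e
    proof -
      obtain R where "measure lebesgue (B - cball 0 R) \<le> e"
        if "B \<in> lmeasurable" "(\<integral>\<^sup>+x\<in>B. ennreal (M - g x) \<partial>lebesgue) \<le> ennreal (I + 1)" for B
        using coercive_potential_tight[OF g assms(5) I1 e, of M] by blast
      then show ?thesis using Em(1) G by blast
    qed
    have "\<exists>k :: nat \<Rightarrow> nat. strict_mono k \<and> (\<forall>e>0. \<exists>N. \<forall>n\<ge>N. \<forall>p\<ge>N.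
        measure lebesgue (sym_diff (E (k n)) (E (k p))) < e)"
    proof (rule bounded_frac_perimeter_Cauchy_subsequence[where E = E, OF assms(1) Em(1) Em(3) P I1])
      show "\<exists>R. \<forall>n. measure lebesgue (E n - cball 0 R) \<le> e" if "0 < e" for e
        using that by (rule tight)
    qed blast
    then obtain k :: "nat \<Rightarrow> nat" where k: "strict_mono k"
      "\<And>e. 0 < e \<Longrightarrow> \<exists>N. \<forall>n\<ge>N. \<forall>p\<ge>N. measure lebesgue (sym_diff (E (k n)) (E (k p))) < e"
      by blast
    obtain r A where r: "strict_mono r" and A: "A \<in> sets lebesgue"
      and lim: "AE x in lebesgue. eventually (\<lambda>n. x \<in> E (k (r n)) \<longleftrightarrow> x \<in> A) sequentially"
      using Cauchy_sets_AE_subsequence[of "\<lambda>n. E (k n)", OF Em(1) k(2)] by blast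
    have "emeasure lebesgue A = ennreal m"
    proof (rule emeasure_AE_lim_Cauchy_sets[OF Em(1) A _ lim Em(2)])
      fix e :: real assume "0 < e"
      then show "\<exists>N. \<forall>n\<ge>N. \<forall>p\<ge>N. measure lebesgue (sym_diff (E (k (r n))) (E (k (r p)))) < e"
        using k(2)[of e] seq_suble[OF r] by (meson order_trans)
    qed
    then have "A \<in> Adm" using A by (simp add: Adm_def)
    have "F A \<le> liminf (\<lambda>n. F (E (k (r n))))"
      unfolding F_def using Em(1) A lim by (intro frac_perimeter_plus_potential_lsc) auto
    also have "\<dots> = ennreal I"
      using LIMSEQ_subseq_LIMSEQ[OF F_lim strict_mono_o[OF k(1) r]]
      by (intro lim_imp_Liminf) (auto simp: o_def)
    finally show ?thesis using \<open>A \<in> Adm\<close> I by auto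
  qed
  then obtain A where A: "A \<in> Adm" "\<And>E. E \<in> Adm \<Longrightarrow> F A \<le> F E"
    by (meson INF_lower order_trans)
  \<comment> \<open>On \<open>Adm\<close> the energy and \<open>F\<close> differ by the finite
    constant \<open>M * m\<close>, so minimality carries over.\<close>
  have "\<not> energy s g E < energy s g A" if "E \<in> Adm" for E
    unfolding not_less energy[OF A(1)] energy[OF that]
    using A(2)[OF that] by (intro ereal_minus_mono) (auto simp: less_eq_ennreal.rep_eq)
  then show ?thesis
    using A(1) by (auto simp: is_arg_min_def Adm_def)
qed

end
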